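(* Let $0\le k\le d+1$. If $B$ is a $k$-shelled $(d+1)$-ball then $\partial B$ is a $k$-stellated $d$-sphere.
   Context: Simplicial complexes are finite and contain the empty set as a face. For a finite set $\alpha$, $\overline{\alpha}$ is the complex of all subsets of $\alpha$, $\partial\alpha$ the complex of all proper subsets, and $\dim(\alpha)=\#(\alpha)-1$; $\ast$ denotes join. The standard ball $B^d_{d+1}$ is the face complex of a $d$-simplex; the standard sphere $S^d_{d+2}$ is the boundary complex of a $(d+1)$-simplex. A weak pseudomanifold is a pure $d$-dimensional complex in which each $(d-1)$-face lies in at most two facets; it is a pseudomanifold if its dual graph (facets as vertices, adjacent when meeting in a codimension-one face) is connected. Its boundary is the pure subcomplex whose facets are the $(d-1)$-faces lying in exactly one facet. Bistellar moves: let $X$ be $d$-dimensional and $\alpha,\beta$ disjoint non-empty finite sets with $\dim(\alpha)+\dim(\beta)=d$ such that the induced subcomplex of $X$ on $\alpha\sqcup\beta$ is $\overline{\alpha}\ast\partial\beta$ (if $\beta$ is a single vertex this means $\beta$ is a new vertex not in $X$). The complex $(X\setminus(\overline{\alpha}\ast\partial\beta))\cup(\partial\alpha\ast\overline{\beta})$ is obtained from $X$ by the bistellar move $\alpha\mapsto\beta$, of index $\dim(\beta)$. For $0\le k\le d+1$, a $d$-dimensional complex is a $k$-stellated $d$-sphere if it is obtained from $S^d_{d+2}$ by a finite (possibly empty) sequence of bistellar moves each of index $<k$. Shelling moves: for pure $d$-dimensional complexes $X,Y$, $X$ is obtained from $Y$ by the shelling move $\alpha\leadsto\beta$ if $\alpha$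 and $\beta\ne\emptyset$ are disjoint faces of $X$ such that $Y\subseteq X$, $\alpha\sqcup\beta$ is the only facet of $X$ which is not a facet of $Y$, and the induced subcomplex of $Y$ on $\alpha\sqcup\beta$ is $\overline{\alpha}\ast\partial\beta$. Its index is $\dim(\beta)$. For $0\le k\le d$, a $d$-dimensional pseudomanifold is a $k$-shelled $d$-ball if it is obtained from $B^d_{d+1}$ by a finite (possibly empty) sequence of shelling moves each of index $<k$. *)

theory Defs
  imports Main
begin

text \<open>
  Dimensions and indices are integers, so that the empty face has dimension \<open>-1\<close>.
\<close>

definition simplicial_complex :: "'a set set \<Rightarrow> bool" where
  "simplicial_complex X \<longleftrightarrow>
     finite X \<and> {} \<in> X \<and> (\<forall>\<sigma>\<in>X. finite \<sigma> \<and> (\<forall>\<tau>. \<tau> \<subseteq> \<sigma> \<longrightarrow> \<tau> \<in> X))"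

definition face_dim :: "'a set \<Rightarrow> int" where
  "face_dim \<sigma> = int (card \<sigma>) - 1"

definition complex_dim :: "'a set set \<Rightarrow> int" where
  "complex_dim X = Max (face_dim ` X)"

definition dim_complex :: "int \<Rightarrow> 'a set set \<Rightarrow> bool" where
  "dim_complex d X \<longleftrightarrow> simplicial_complex X \<and> complex_dim X = d"

definition facets :: "'a set set \<Rightarrow> 'a set set" where
  "facets X = {\<sigma> \<in> X. \<forall>\<tau>\<in>X. \<sigma> \<subseteq> \<tau> \<longrightarrow> \<tau> = \<sigma>}"

definition pure_complex :: "int \<Rightarrow> 'a set set \<Rightarrow> bool" where
  "pure_complex d X \<longleftrightarrow> dim_complex d X \<and> (\<forall>\<sigma>\<in>facets X. face_dim \<sigma> = d)"

text \<open>The complex of all subsets of \<open>\<alpha>\<close> is \<open>Pow \<alpha>\<close>.\<close>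

definition proper_faces :: "'a set \<Rightarrow> 'a set set" where
  "proper_faces \<alpha> = {\<gamma>. \<gamma> \<subset> \<alpha>}"

text \<open>Only used for complexes on disjoint vertex sets.\<close>

definition join :: "'a set set \<Rightarrow> 'a set set \<Rightarrow> 'a set set" where
  "join X Y = {\<sigma> \<union> \<tau> | \<sigma> \<tau>. \<sigma> \<in> X \<and> \<tau> \<in> Y}"

definition induced :: "'a set set \<Rightarrow> 'a set \<Rightarrow> 'a set set" where
  "induced X A = {\<sigma> \<in> X. \<sigma> \<subseteq> A}"

definition standard_ball :: "int \<Rightarrow> 'a set set \<Rightarrow> bool" where
  "standard_ball d X \<longleftrightarrow> (\<exists>\<sigma>. finite \<sigma> \<and> face_dim \<sigma> = d \<and> X = Pow \<sigma>)"

definition standard_sphere :: "int \<Rightarrow> 'a set set \<Rightarrow> bool" where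
  "standard_sphere d X \<longleftrightarrow> (\<exists>\<sigma>. finite \<sigma> \<and> face_dim \<sigma> = d + 1 \<and> X = proper_faces \<sigma>)"

definition weak_pseudomanifold :: "int \<Rightarrow> 'a set set \<Rightarrow> bool" where
  "weak_pseudomanifold d X \<longleftrightarrow>
     pure_complex d X \<and>
     (\<forall>\<tau>\<in>X. face_dim \<tau> = d - 1 \<longrightarrow> card {\<sigma> \<in> facets X. \<tau> \<subseteq> \<sigma>} \<le> 2)"

definition dual_adj :: "int \<Rightarrow> 'a set set \<Rightarrow> ('a set \<times> 'a set) set" where
  "dual_adj d X =
     {(\<sigma>, \<tau>). \<sigma> \<in> facets X \<and> \<tau> \<in> facets X \<and> face_dim (\<sigma> \<inter> \<tau>) = d - 1}"

definition pseudomanifold :: "int \<Rightarrow> 'a set set \<Rightarrow> bool" where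
  "pseudomanifold d X \<longleftrightarrow>
     weak_pseudomanifold d X \<and>
     (\<forall>\<sigma>\<in>facets X. \<forall>\<tau>\<in>facets X. (\<sigma>, \<tau>) \<in> (dual_adj d X)\<^sup>*)"

text \<open>
  The empty face is inserted explicitly because every complex contains it; this only
  matters when no codimension-one face lies in exactly one facet.
\<close>

definition boundary :: "'a set set \<Rightarrow> 'a set set" where
  "boundary X =
     insert {}
       {\<rho>. \<exists>\<tau>\<in>X. face_dim \<tau> = complex_dim X - 1 \<and>
                 card {\<sigma> \<in> facets X. \<tau> \<subseteq> \<sigma>} = 1 \<and> \<rho> \<subseteq> \<tau>}"

text \<open>
  \<open>bistellar_move d X \<alpha> \<beta> X'\<close>: the move \<open>\<alpha> \<mapsto> \<beta>\<close> turns \<open>X\<close> into \<open>X'\<close>.  If \<open>\<beta> = {v}\<close>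
  then \<open>proper_faces \<beta> = {{}}\<close>, so the condition on the induced subcomplex says that
  \<open>\<alpha>\<close> is a face of \<open>X\<close> and \<open>v\<close> is not a vertex of \<open>X\<close>.
\<close>

definition bistellar_move ::
  "int \<Rightarrow> 'a set set \<Rightarrow> 'a set \<Rightarrow> 'a set \<Rightarrow> 'a set set \<Rightarrow> bool" where
  "bistellar_move d X \<alpha> \<beta> X' \<longleftrightarrow>
     dim_complex d X \<and>
     finite \<alpha> \<and> finite \<beta> \<and> \<alpha> \<noteq> {} \<and> \<beta> \<noteq> {} \<and> \<alpha> \<inter> \<beta> = {} \<and>
     face_dim \<alpha> + face_dim \<beta> = d \<and>
     induced X (\<alpha> \<union> \<beta>) = join (Pow \<alpha>) (proper_faces \<beta>) \<and>
     X' = (X - join (Pow \<alpha>) (proper_faces \<beta>)) \<union> join (proper_faces \<alpha>) (Pow \<beta>)"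

definition stellated_sphere :: "int \<Rightarrow> int \<Rightarrow> 'a set set \<Rightarrow> bool" where
  "stellated_sphere k d X \<longleftrightarrow>
     dim_complex d X \<and>
     (\<exists>S. standard_sphere d S \<and>
          (\<lambda>Y Z. \<exists>\<alpha> \<beta>. bistellar_move d Y \<alpha> \<beta> Z \<and> face_dim \<beta> < k)\<^sup>*\<^sup>* S X)"

text \<open>
  \<open>shelling_move d Y \<alpha> \<beta> X\<close>: the complex \<open>X\<close> is obtained from the smaller complex \<open>Y\<close>.
  Here \<open>\<alpha>\<close> may be empty.
\<close>

definition shelling_move ::
  "int \<Rightarrow> 'a set set \<Rightarrow> 'a set \<Rightarrow> 'a set \<Rightarrow> 'a set set \<Rightarrow> bool" where
  "shelling_move d Y \<alpha> \<beta> X \<longleftrightarrow>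
     pure_complex d Y \<and> pure_complex d X \<and>
     \<alpha> \<in> X \<and> \<beta> \<in> X \<and> \<beta> \<noteq> {} \<and> \<alpha> \<inter> \<beta> = {} \<and>
     Y \<subseteq> X \<and> facets X - facets Y = {\<alpha> \<union> \<beta>} \<and>
     induced Y (\<alpha> \<union> \<beta>) = join (Pow \<alpha>) (proper_faces \<beta>)"

definition shelled_ball :: "int \<Rightarrow> int \<Rightarrow> 'a set set \<Rightarrow> bool" where
  "shelled_ball k d X \<longleftrightarrow>
     pseudomanifold d X \<and>
     (\<exists>B. standard_ball d B \<and>
          (\<lambda>Y Z. \<exists>\<alpha> \<beta>. shelling_move d Y \<alpha> \<beta> Z \<and> face_dim \<beta> < k)\<^sup>*\<^sup>* B X)"

end

theory Submission
  imports Defs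
begin

text \<open>
  A shelling move \<open>\<alpha> \<leadsto> \<beta>\<close> glues the simplex \<open>\<sigma> = \<alpha> \<union> \<beta>\<close> along the ridges \<open>\<sigma> - {b}\<close>,
  \<open>b \<in> \<beta>\<close>.  These ridges leave the boundary and the ridges \<open>\<sigma> - {a}\<close>, \<open>a \<in> \<alpha>\<close>, enter it; the
  index bound makes \<open>\<alpha>\<close> non-empty.  This is the bistellar move \<open>\<alpha> \<mapsto> \<beta>\<close> on the boundary provided
  that no other boundary facet contains \<open>\<alpha>\<close>, as the faces containing \<open>\<alpha>\<close> have to disappear.  To
  guarantee this one carries along that in the boundary the star of every face is strongly connected:
  the facets \<open>\<sigma> - {b}\<close> form a closed pseudomanifold within the star of \<open>\<alpha>\<close>, hence exhaust it.
\<close>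

section \<open>Uniform families\<close>

text \<open>Here \<open>n\<close> counts vertices, so the members generate a complex of dimension
  \<open>n - 1\<close>. Non-emptiness puts the empty face into \<open>down F\<close>, even for
  \<open>n = 0\<close>.\<close>

definition uniform :: "nat \<Rightarrow> 'a set set \<Rightarrow> bool" where
  "uniform n F \<longleftrightarrow> finite F \<and> F \<noteq> {} \<and> (\<forall>s\<in>F. finite s \<and> card s = n)"

definition down :: "'a set set \<Rightarrow> 'a set set" where
  "down F = {\<rho>. \<exists>s\<in>F. \<rho> \<subseteq> s}"

text \<open>The weak pseudomanifold condition in pigeonhole form, with three members instead of a
  cardinality; it is inherited by subfamilies at once.\<close>

definition thin :: "nat \<Rightarrow> 'a set set \<Rightarrow> bool" where
  "thin n F \<longleftrightarrow> (\<forall>\<rho> s t u. card \<rho> = n \<longrightarrow> s \<in> F \<longrightarrow> t \<in> F \<longrightarrow> u \<in> F \<longrightarrow>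
     \<rho> \<subseteq> s \<longrightarrow> \<rho> \<subseteq> t \<longrightarrow> \<rho> \<subseteq> u \<longrightarrow> s = t \<or> s = u \<or> t = u)"

text \<open>When \<open>F\<close> consists of the facets of a pure \<open>n\<close>-dimensional
  complex, these are the facets of its boundary.\<close>

definition free_ridges :: "nat \<Rightarrow> 'a set set \<Rightarrow> 'a set set" where
  "free_ridges n F = {\<tau>. card \<tau> = n \<and> (\<exists>!s. s \<in> F \<and> \<tau> \<subseteq> s)}"

text \<open>For \<open>A\<close> inside \<sigma>, the ridges of the simplex \<sigma> opposite the
  vertices in \<open>A\<close>; \<open>ridges \<sigma> \<sigma>\<close> generates its boundary
  sphere.\<close>

definition ridges :: "'a set \<Rightarrow> 'a set \<Rightarrow> 'a set set" where
  "ridges \<sigma> A = (\<lambda>x. \<sigma> - {x}) ` A"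

lemma uniformD:
  assumes "uniform n F" "s \<in> F"
  shows "finite s" "card s = n"
  using assms by (auto simp: uniform_def)

lemma thinD:
  assumes "thin n F" "card \<rho> = n" "s \<in> F" "t \<in> F" "u \<in> F" "\<rho> \<subseteq> s" "\<rho> \<subseteq> t" "\<rho> \<subseteq> u"
  shows "s = t \<or> s = u \<or> t = u"
  using assms unfolding thin_def by blast

lemma thin_subset:
  assumes "thin n F" "G \<subseteq> F"
  shows "thin n G"
  unfolding thin_def
proof (intro allI impI)
  fix \<rho> s t u
  assume "card \<rho> = n" "s \<in> G" "t \<in> G" "u \<in> G" "\<rho> \<subseteq> s" "\<rho> \<subseteq> t" "\<rho> \<subseteq> u"
  then show "s = t \<or> s = u \<or> t = u"
    using thinD[OF assms(1), of \<rho> s t u] assms(2) by (simp add: subset_iff)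
qed

lemma subset_eq_Diff_singleton:
  assumes "finite s" "t \<subseteq> s" "Suc (card t) = card s"
  obtains x where "x \<in> s" "t = s - {x}"
proof -
  have "card (s - t) = 1"
    using assms by (subst card_Diff_subset) (auto intro: finite_subset)
  then obtain x where "s - t = {x}"
    by (auto simp: card_1_singleton_iff)
  then show ?thesis
    using that[of x] assms(2) by blast
qed

section \<open>Uniform families and pure complexes\<close>

lemma dim_complex_down:
  assumes "uniform n F"
  shows "dim_complex (int n - 1) (down F)"
proof -
  have eq: "down F = (\<Union>s\<in>F. Pow s)"
    by (auto simp: down_def)
  have fin: "finite (down F)"
    unfolding eq using assms by (auto simp: uniform_def)
  have "simplicial_complex (down F)"
    unfolding simplicial_complex_def
  proof (intro conjI ballI allI impI)
    show "finite (down F)" by (rule fin)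
    show "{} \<in> down F" using assms by (auto simp: uniform_def down_def)
    show "finite \<rho>" if "\<rho> \<in> down F" for \<rho>
      using that uniformD(1)[OF assms] finite_subset unfolding down_def by blast
    show "\<tau> \<in> down F" if "\<rho> \<in> down F" "\<tau> \<subseteq> \<rho>" for \<rho> \<tau>
      using that by (auto simp: down_def)
  qed
  moreover have "complex_dim (down F) = int n - 1"
    unfolding complex_dim_def
  proof (rule Max_eqI)
    show "finite (face_dim ` down F)" using fin by simp
    show "x \<le> int n - 1" if x: "x \<in> face_dim ` down F" for x
    proof -
      from x obtain \<rho> s where "x = face_dim \<rho>" "s \<in> F" "\<rho> \<subseteq> s" by (auto simp: down_def)
      then show ?thesis
        using uniformD[OF assms, of s] card_mono[of s \<rho>] by (simp add: face_dim_def)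
    qed
    from assms obtain s where "s \<in> F" by (auto simp: uniform_def)
    then show "int n - 1 \<in> face_dim ` down F"
      using uniformD[OF assms] by (intro image_eqI[of _ _ s]) (auto simp: face_dim_def down_def)
  qed
  ultimately show ?thesis
    by (simp add: dim_complex_def)
qed

text \<open>By finiteness every face extends to a maximal one, so a pure complex can be replaced by
  its family of facets. Applied to the empty face, this also shows that there is a facet.\<close>

lemma pure_complex_facets:
  assumes "pure_complex (int n - 1) Y"
  shows "uniform n (facets Y)" "Y = down (facets Y)"
proof -
  have sc: "simplicial_complex Y" and dim: "\<And>s. s \<in> facets Y \<Longrightarrow> face_dim s = int n - 1"
    using assms by (auto simp: pure_complex_def dim_complex_def)
  have max: "\<exists>s\<in>facets Y. \<rho> \<subseteq> s" if "\<rho> \<in> Y" for \<rho>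
    using finite_has_maximal2[of Y \<rho>] that sc by (auto simp: simplicial_complex_def facets_def)
  show "uniform n (facets Y)"
    using sc dim max[of "{}"]
    by (auto simp: uniform_def simplicial_complex_def face_dim_def facets_def)
  show "Y = down (facets Y)"
  proof
    show "Y \<subseteq> down (facets Y)" using max by (auto simp: down_def)
    show "down (facets Y) \<subseteq> Y"
      using sc unfolding down_def facets_def simplicial_complex_def by blast
  qed
qed

lemma pure_complex_facetI:
  assumes "pure_complex (int n - 1) Y" "s \<in> Y" "card s = n"
  shows "s \<in> facets Y"
proof -
  obtain t where t: "t \<in> facets Y" "s \<subseteq> t"
    using assms(2) pure_complex_facets(2)[OF assms(1)] by (auto simp: down_def)
  then have "s = t"
    using uniformD[OF pure_complex_facets(1)[OF assms(1)] t(1)] assms(3)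
    by (intro card_subset_eq) auto
  with t show ?thesis by simp
qed

lemma card_eq_1_iff_Ex1: "card {x. P x} = 1 \<longleftrightarrow> (\<exists>!x. P x)"
proof -
  have "card {x. P x} = 1 \<longleftrightarrow> (\<exists>x. \<forall>y. P y \<longleftrightarrow> y = x)"
    by (simp add: card_1_singleton_iff set_eq_iff)
  then show ?thesis by metis
qed

lemma boundary_eq_down_free_ridges:
  assumes "pure_complex (int n) X"
  shows "boundary X = insert {} (down (free_ridges n (facets X)))"
proof -
  have X: "X = down (facets X)"
    using pure_complex_facets(2)[of "Suc n" X] assms by simp
  have dim: "complex_dim X = int n"
    using assms by (simp add: pure_complex_def dim_complex_def)
  have iff: "\<tau> \<in> X \<and> face_dim \<tau> = complex_dim X - 1 \<and> card {s \<in> facets X. \<tau> \<subseteq> s} = 1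
      \<longleftrightarrow> \<tau> \<in> free_ridges n (facets X)" for \<tau>
  proof -
    have "card {s \<in> facets X. \<tau> \<subseteq> s} = 1 \<longleftrightarrow> (\<exists>!s. s \<in> facets X \<and> \<tau> \<subseteq> s)"
      by (rule card_eq_1_iff_Ex1)
    moreover have "(\<exists>!s. s \<in> facets X \<and> \<tau> \<subseteq> s) \<longrightarrow> \<tau> \<in> X"
    proof
      assume "\<exists>!s. s \<in> facets X \<and> \<tau> \<subseteq> s"
      then have "\<tau> \<in> down (facets X)" unfolding down_def by blast
      with X show "\<tau> \<in> X" by simp
    qed
    moreover have "face_dim \<tau> = complex_dim X - 1 \<longleftrightarrow> card \<tau> = n"
      by (simp add: dim face_dim_def)
    ultimately show ?thesis
      unfolding free_ridges_def mem_Collect_eq by satx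
  qed
  have "(\<exists>\<tau>\<in>X. face_dim \<tau> = complex_dim X - 1 \<and> card {s \<in> facets X. \<tau> \<subseteq> s} = 1 \<and> \<rho> \<subseteq> \<tau>)
      \<longleftrightarrow> (\<exists>\<tau>\<in>free_ridges n (facets X). \<rho> \<subseteq> \<tau>)" for \<rho>
    unfolding Bex_def iff[symmetric] by (simp only: conj_assoc)
  then show ?thesis
    by (simp only: boundary_def down_def)
qed

section \<open>Normal families\<close>

text \<open>The dual graph of the star of \<rho>, for facets with \<open>n + 1\<close> vertices;
  \<rho> = \<open>{}\<close> gives the whole dual graph.\<close>

definition star_adj :: "nat \<Rightarrow> 'a set set \<Rightarrow> 'a set \<Rightarrow> ('a set \<times> 'a set) set" where
  "star_adj n F \<rho> = {(s, t). s \<in> F \<and> t \<in> F \<and> \<rho> \<subseteq> s \<and> \<rho> \<subseteq> t \<and> card (s \<inter> t) = n}"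

text \<open>A form of the notion of normal pseudomanifold, with strongly connected stars in place of
  connected links. This is the invariant kept along the moves.\<close>

definition normal :: "nat \<Rightarrow> 'a set set \<Rightarrow> bool" where
  "normal n F \<longleftrightarrow> uniform (Suc n) F \<and> thin n F \<and>
     (\<forall>\<rho>. \<forall>s\<in>F. \<forall>t\<in>F. \<rho> \<subseteq> s \<longrightarrow> \<rho> \<subseteq> t \<longrightarrow> (s, t) \<in> (star_adj n F \<rho>)\<^sup>*)"

lemma star_adj_sym: "sym (star_adj n F \<rho>)"
  by (auto simp: sym_def star_adj_def Int_commute)

lemma star_adj_ridges:
  assumes "finite \<sigma>" "card \<sigma> = n + 2" "x \<in> \<sigma>" "y \<in> \<sigma>" "\<sigma> - {x} \<in> F" "\<sigma> - {y} \<in> F"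
    "\<rho> \<subseteq> \<sigma> - {x}" "\<rho> \<subseteq> \<sigma> - {y}"
  shows "(\<sigma> - {x}, \<sigma> - {y}) \<in> (star_adj n F \<rho>)\<^sup>*"
proof (cases "x = y")
  case False
  have "(\<sigma> - {x}) \<inter> (\<sigma> - {y}) = \<sigma> - {x, y}" by auto
  moreover have "card (\<sigma> - {x, y}) = n"
    using assms False by (subst card_Diff_subset) auto
  ultimately have "card ((\<sigma> - {x}) \<inter> (\<sigma> - {y})) = n"
    by simp
  then have "(\<sigma> - {x}, \<sigma> - {y}) \<in> star_adj n F \<rho>"
    using assms unfolding star_adj_def by blast
  then show ?thesis by simp
qed simp

text \<open>The boundary of a simplex starts the induction, and its thinness is used again for the
  new ridges of an exchange. Any two ridges are adjacent; three distinct ones share only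
  \<open>n - 1\<close> vertices, too few for a common \<open>n\<close>-set.\<close>

lemma normal_ridges:
  assumes "finite \<sigma>" "card \<sigma> = n + 2"
  shows "normal n (ridges \<sigma> \<sigma>)"
proof -
  have "uniform (Suc n) (ridges \<sigma> \<sigma>)"
    using assms by (auto simp: uniform_def ridges_def)
  moreover have "thin n (ridges \<sigma> \<sigma>)"
    unfolding thin_def
  proof (intro allI impI)
    fix \<rho> s t u
    assume \<rho>: "card \<rho> = n" "\<rho> \<subseteq> s" "\<rho> \<subseteq> t" "\<rho> \<subseteq> u"
      and "s \<in> ridges \<sigma> \<sigma>" "t \<in> ridges \<sigma> \<sigma>" "u \<in> ridges \<sigma> \<sigma>"
    then obtain x y z where xyz: "x \<in> \<sigma>" "y \<in> \<sigma>" "z \<in> \<sigma>"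
      "s = \<sigma> - {x}" "t = \<sigma> - {y}" "u = \<sigma> - {z}"
      by (auto simp: ridges_def)
    \<comment> \<open>The set \<rho> avoids the omitted vertices, so both fit disjointly into the
      \<open>n + 2\<close> vertices of \<sigma>.\<close>
    have "card (\<rho> \<union> {x, y, z}) \<le> n + 2"
      using \<rho> xyz assms card_mono[of \<sigma> "\<rho> \<union> {x, y, z}"] by auto
    moreover have "card (\<rho> \<union> {x, y, z}) = n + card {x, y, z}"
      using \<rho> xyz finite_subset[of \<rho> \<sigma>] assms by (subst card_Un_disjoint) auto
    ultimately have "card {x, y, z} \<le> 2" by simp
    then have "x = y \<or> x = z \<or> y = z"
      by (auto simp: card_insert_if split: if_splits)
    with xyz show "s = t \<or> s = u \<or> t = u" by auto
  qed
  moreover have "(s, t) \<in> (star_adj n (ridges \<sigma> \<sigma>) \<rho>)\<^sup>*"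
    if "s \<in> ridges \<sigma> \<sigma>" "t \<in> ridges \<sigma> \<sigma>" "\<rho> \<subseteq> s" "\<rho> \<subseteq> t" for \<rho> s t
    using that assms by (auto simp: ridges_def intro!: star_adj_ridges)
  ultimately show ?thesis
    by (simp add: normal_def)
qed

section \<open>The exchange of ridges\<close>

text \<open>Turns membership in a join into two inclusion tests, the form in which all later
  arguments use it.\<close>

lemma join_Pow_proper_faces:
  assumes "\<alpha> \<inter> \<beta> = {}"
  shows "join (Pow \<alpha>) (proper_faces \<beta>) = {\<rho>. \<rho> \<subseteq> \<alpha> \<union> \<beta> \<and> \<not> \<beta> \<subseteq> \<rho>}" (is "?L = ?R")
proof
  show "?L \<subseteq> ?R"
    using assms by (auto simp: join_def proper_faces_def)
  show "?R \<subseteq> ?L"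
  proof
    fix \<rho> assume "\<rho> \<in> ?R"
    then have "\<rho> = (\<rho> \<inter> \<alpha>) \<union> (\<rho> \<inter> \<beta>)" "\<rho> \<inter> \<alpha> \<in> Pow \<alpha>" "\<rho> \<inter> \<beta> \<in> proper_faces \<beta>"
      by (auto simp: proper_faces_def)
    then show "\<rho> \<in> ?L" unfolding join_def by blast
  qed
qed

lemma join_commute: "join X Y = join Y X"
  unfolding join_def by (metis (no_types, opaque_lifting) Un_commute)

lemma join_proper_faces_Pow:
  assumes "\<alpha> \<inter> \<beta> = {}"
  shows "join (proper_faces \<alpha>) (Pow \<beta>) = {\<rho>. \<rho> \<subseteq> \<alpha> \<union> \<beta> \<and> \<not> \<alpha> \<subseteq> \<rho>}"
  using join_Pow_proper_faces[of \<beta> \<alpha>] assms by (simp add: join_commute Int_commute Un_commute)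

text \<open>The family \<open>F\<close> models the boundary facets before a move, and \<alpha>
  \<union> \<beta> the glued simplex, one dimension higher. The assumptions
  \<open>ridges_\<beta>\<close> and \<open>\<beta>_nonface\<close> fix the induced subcomplex of a
  bistellar move; normality controls the star of \<alpha>.\<close>

locale ridge_exchange =
  fixes n :: nat and F :: "'a set set" and \<alpha> \<beta> :: "'a set"
  assumes normal: "normal n F"
    and finite_\<alpha>: "finite \<alpha>" and finite_\<beta>: "finite \<beta>"
    and disjoint: "\<alpha> \<inter> \<beta> = {}"
    and \<alpha>_ne: "\<alpha> \<noteq> {}" and \<beta>_ne: "\<beta> \<noteq> {}"
    and card: "card (\<alpha> \<union> \<beta>) = n + 2"
    and ridges_\<beta>: "ridges (\<alpha> \<union> \<beta>) \<beta> \<subseteq> F"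
    and \<beta>_nonface: "\<And>t. t \<in> F \<Longrightarrow> \<not> \<beta> \<subseteq> t"
begin

abbreviation \<sigma> where "\<sigma> \<equiv> \<alpha> \<union> \<beta>"

abbreviation F' where "F' \<equiv> (F - ridges \<sigma> \<beta>) \<union> ridges \<sigma> \<alpha>"

lemma finite_\<sigma>: "finite \<sigma>"
  using finite_\<alpha> finite_\<beta> by simp

lemma uniform_F: "uniform (Suc n) F" and thin_F: "thin n F"
  using normal by (auto simp: normal_def)

lemma connected_F:
  "\<lbrakk>s \<in> F; t \<in> F; \<rho> \<subseteq> s; \<rho> \<subseteq> t\<rbrakk> \<Longrightarrow> (s, t) \<in> (star_adj n F \<rho>)\<^sup>*"
  using normal unfolding normal_def by blast

lemma card_minus: "x \<in> \<sigma> \<Longrightarrow> card (\<sigma> - {x}) = Suc n"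
  using finite_\<sigma> card by simp

lemma card_minus2: "\<lbrakk>x \<in> \<sigma>; y \<in> \<sigma>; x \<noteq> y\<rbrakk> \<Longrightarrow> card (\<sigma> - {x} - {y}) = n"
  using finite_\<sigma> card by simp

lemma ridge_\<beta>: "b \<in> \<beta> \<Longrightarrow> \<sigma> - {b} \<in> F"
  using ridges_\<beta> by (auto simp: ridges_def)

text \<open>Walk inside the star of \<alpha>, starting from a ridge opposite a vertex of \<beta>.
  Each step crosses an \<open>n\<close>-set that two such ridges already share, so by thinness the
  walk never leaves these ridges.\<close>

lemma star_\<alpha>:
  assumes "t \<in> F" "\<alpha> \<subseteq> t"
  shows "t \<in> ridges \<sigma> \<beta>"
proof -
  obtain b where b: "b \<in> \<beta>" using \<beta>_ne by blast
  then have "\<alpha> \<subseteq> \<sigma> - {b}" using disjoint by blast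
  then have "(\<sigma> - {b}, t) \<in> (star_adj n F \<alpha>)\<^sup>*"
    using connected_F ridge_\<beta> b assms by simp
  then show ?thesis
  proof (induction rule: rtrancl_induct)
    case base
    then show ?case using b by (simp add: ridges_def)
  next
    case (step s t)
    from step.IH obtain b where b: "b \<in> \<beta>" "s = \<sigma> - {b}" by (auto simp: ridges_def)
    have st: "t \<in> F" "\<alpha> \<subseteq> s" "\<alpha> \<subseteq> t" "card (s \<inter> t) = n"
      using step.hyps by (auto simp: star_adj_def)
    obtain x where x: "x \<in> s" "s \<inter> t = s - {x}"
      using subset_eq_Diff_singleton[of s "s \<inter> t"] b st finite_\<sigma> card_minus[of b] by auto
    \<comment> \<open>The vertex \<open>x\<close> dropped in the step is not in \<alpha>, because
      \<alpha> lies in both \<open>s\<close> and \<open>t\<close>.\<close>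
    have "x \<in> \<beta>" "x \<noteq> b" using x st b by auto
    moreover have "card (\<sigma> - {b} - {x}) = n" using st x b by simp
    moreover have "t \<noteq> \<sigma> - {b}" using st b card_minus[of b] by auto
    moreover have "\<sigma> - {b} - {x} \<subseteq> t" using x b by auto
    ultimately have "t = \<sigma> - {x}"
      using thinD[OF thin_F, of "\<sigma> - {b} - {x}" "\<sigma> - {b}" "\<sigma> - {x}" t] ridge_\<beta> b st
      by auto
    with \<open>x \<in> \<beta>\<close> show ?case by (simp add: ridges_def)
  qed
qed

section \<open>Invariance of normality under the exchange\<close>

lemma uniform_F': "uniform (Suc n) F'"
  using uniform_F finite_\<alpha> finite_\<beta> \<alpha>_ne card
  by (auto simp: uniform_def ridges_def)

text \<open>Three old members are handled by thinness of \<open>F\<close>, three new ones by the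
  boundary of \<sigma>. In the mixed case the removed ridge frees exactly the place that the new
  ridge takes.\<close>

lemma thin_F': "thin n F'"
proof -
  \<comment> \<open>Below both a new ridge \<open>\<sigma> - {a}\<close> and a survivor
    \<open>s\<close>, the \<open>n\<close>-set \<rho> has no room for a third member.\<close>
  have two: "s = t"
    if *: "card \<rho> = n" "\<rho> \<subseteq> \<sigma> - {a}" "a \<in> \<alpha>" "s \<in> F - ridges \<sigma> \<beta>" "t \<in> F'"
      "\<rho> \<subseteq> s" "\<rho> \<subseteq> t" "t \<noteq> \<sigma> - {a}" for \<rho> a s t
  proof -
    have "finite (\<sigma> - {a})" using finite_\<sigma> by blast
    moreover have "Suc (card \<rho>) = card (\<sigma> - {a})" using card_minus[of a] *(1,3) by simp
    ultimately obtain b where b: "b \<in> \<sigma> - {a}" "\<rho> = \<sigma> - {a} - {b}"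
      by (rule subset_eq_Diff_singleton[OF _ *(2)])
    \<comment> \<open>Since \<beta> is not a face of the old complex, the second vertex missing from
      \<rho> lies in \<beta>.\<close>
    have "\<not> \<beta> \<subseteq> \<rho>" using \<beta>_nonface[of s] *(4,6) by blast
    moreover have "\<beta> \<subseteq> \<sigma> - {a}" using disjoint *(3) by blast
    ultimately have "b \<in> \<beta>" using b by blast
    have "t \<in> F - ridges \<sigma> \<beta>"
    proof (rule ccontr)
      assume "t \<notin> F - ridges \<sigma> \<beta>"
      then obtain a' where a': "a' \<in> \<alpha>" "t = \<sigma> - {a'}"
        using * by (auto simp: ridges_def)
      then have "a' \<noteq> a" using that by auto
      then have "a' \<in> \<rho>" using a' b \<open>b \<in> \<beta>\<close> disjoint by auto
      with a' that show False by auto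
    qed
    moreover have "\<sigma> - {b} \<in> ridges \<sigma> \<beta>" using \<open>b \<in> \<beta>\<close> by (simp add: ridges_def)
    moreover have "\<rho> \<subseteq> \<sigma> - {b}" using b by auto
    \<comment> \<open>The removed ridge \<open>\<sigma> - {b}\<close> is one of the at most two old
      members over \<rho>, which leaves a single survivor.\<close>
    ultimately show ?thesis
      using thinD[OF thin_F, of \<rho> s t "\<sigma> - {b}"] that ridge_\<beta>[OF \<open>b \<in> \<beta>\<close>] by auto
  qed
  show ?thesis
    unfolding thin_def
  proof (intro allI impI)
    fix \<rho> s t u
    assume *: "card \<rho> = n" "s \<in> F'" "t \<in> F'" "u \<in> F'" "\<rho> \<subseteq> s" "\<rho> \<subseteq> t" "\<rho> \<subseteq> u"
    then have stu: "{s, t, u} \<subseteq> F'" "\<And>w. w \<in> {s, t, u} \<Longrightarrow> \<rho> \<subseteq> w" by auto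
    show "s = t \<or> s = u \<or> t = u"
    proof (cases "{s, t, u} \<subseteq> F")
      case True
      with * show ?thesis using thinD[OF thin_F, of \<rho> s t u] by simp
    next
      case not_old: False
      show ?thesis
      proof (cases "{s, t, u} \<subseteq> ridges \<sigma> \<alpha>")
        case True
        then have "s \<in> ridges \<sigma> \<sigma>" "t \<in> ridges \<sigma> \<sigma>" "u \<in> ridges \<sigma> \<sigma>"
          by (auto simp: ridges_def)
        moreover have "thin n (ridges \<sigma> \<sigma>)"
          using normal_ridges[OF finite_\<sigma> card] by (simp add: normal_def)
        ultimately show ?thesis using * thinD[of n "ridges \<sigma> \<sigma>" \<rho> s t u] by simp
      next
        case False
        then obtain v where v: "v \<in> {s, t, u}" "v \<in> F - ridges \<sigma> \<beta>"
          using stu(1) by blast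
        obtain w where "w \<in> {s, t, u}" "w \<in> ridges \<sigma> \<alpha>"
          using not_old stu(1) by blast
        then obtain a where a: "a \<in> \<alpha>" "\<rho> \<subseteq> \<sigma> - {a}"
          using stu(2)[of w] by (auto simp: ridges_def)
        \<comment> \<open>All three members take only two values, so two of them coincide.\<close>
        have "w = \<sigma> - {a} \<or> w = v" if w: "w \<in> {s, t, u}" for w
        proof -
          have "w \<in> F'" using w stu(1) by (rule subsetD[rotated])
          then show ?thesis
            using two[OF *(1) a(2,1) v(2) _ stu(2)[OF v(1)] stu(2)[OF w]] by metis
        qed
        from this[of s] this[of t] this[of u] show ?thesis by auto
      qed
    qed
  qed
qed

text \<open>If \<rho> is not inside \<sigma>, its star is untouched. Otherwise every member of the
  star is linked to a new ridge, and the new ridges are pairwise equal or adjacent.\<close>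

lemma connected_F':
  assumes "s \<in> F'" "t \<in> F'" "\<rho> \<subseteq> s" "\<rho> \<subseteq> t"
  shows "(s, t) \<in> (star_adj n F' \<rho>)\<^sup>*"
proof -
  let ?R' = "(star_adj n F' \<rho>)\<^sup>*"
  have sym: "(x, y) \<in> ?R' \<Longrightarrow> (y, x) \<in> ?R'" for x y
    using sym_rtrancl[OF star_adj_sym] by (rule symD)
  have new: "(\<sigma> - {a}, \<sigma> - {a'}) \<in> ?R'"
    if "a \<in> \<alpha>" "a' \<in> \<alpha>" "\<rho> \<subseteq> \<sigma> - {a}" "\<rho> \<subseteq> \<sigma> - {a'}" for a a'
    by (rule star_adj_ridges) (use that finite_\<sigma> card in \<open>auto simp: ridges_def\<close>)
  have keep: "x \<in> F - ridges \<sigma> \<beta>" if "x \<in> F'" "\<not> \<rho> \<subseteq> \<sigma>" "\<rho> \<subseteq> x" for x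
    using that by (auto simp: ridges_def)
  show ?thesis
  proof (cases "\<rho> \<subseteq> \<sigma>")
    case False
    then have "star_adj n F \<rho> \<subseteq> star_adj n F' \<rho>"
      by (auto simp: star_adj_def ridges_def)
    moreover have "(s, t) \<in> (star_adj n F \<rho>)\<^sup>*"
      using keep assms False connected_F by blast
    ultimately show ?thesis by (meson rtrancl_mono subsetD)
  next
    case \<rho>: True
    \<comment> \<open>Follow an old path towards a removed ridge and, just before it first enters
      one, turn off to a new ridge.\<close>
    have reach: "\<exists>a\<in>\<alpha>. \<rho> \<subseteq> \<sigma> - {a} \<and> (x, \<sigma> - {a}) \<in> ?R'"
      if x_in: "x \<in> F'" and "\<rho> \<subseteq> x" for x
    proof (cases "x \<in> ridges \<sigma> \<alpha>")
      case True
      with that show ?thesis by (auto simp: ridges_def)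
    next
      case False
      with x_in have x: "x \<in> F - ridges \<sigma> \<beta>" by blast
      then have "\<not> \<beta> \<subseteq> \<rho>" using \<beta>_nonface[of x] \<open>\<rho> \<subseteq> x\<close> by blast
      then obtain b where b: "b \<in> \<beta>" "b \<notin> \<rho>" by blast
      then have b\<rho>: "\<rho> \<subseteq> \<sigma> - {b}" using \<rho> by blast
      then have "(x, \<sigma> - {b}) \<in> (star_adj n F \<rho>)\<^sup>*"
        using x that ridge_\<beta> b connected_F by simp
      then show ?thesis
        using x
      proof (induction rule: converse_rtrancl_induct)
        \<comment> \<open>Vacuous: the path ends in a removed ridge, while the induction keeps its
          current vertex a survivor.\<close>
        case base
        with b show ?case by (auto simp: ridges_def)
      next
        case (step x y)
        have xy: "x \<in> F" "y \<in> F" "\<rho> \<subseteq> x" "\<rho> \<subseteq> y" "card (x \<inter> y) = n"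
          using step.hyps by (auto simp: star_adj_def)
        show ?case
        proof (cases "y \<in> ridges \<sigma> \<beta>")
          case False
          then have "(x, y) \<in> star_adj n F' \<rho>"
            using xy step.prems by (auto simp: star_adj_def)
          with step.IH False xy show ?thesis
            by (meson DiffI converse_rtrancl_into_rtrancl)
        next
          case True
          then obtain b where b: "b \<in> \<beta>" "y = \<sigma> - {b}" by (auto simp: ridges_def)
          then obtain a where a: "a \<in> y" "x \<inter> y = y - {a}"
            using subset_eq_Diff_singleton[of y "x \<inter> y"] xy finite_\<sigma> card_minus[of b] by auto
          \<comment> \<open>A survivor containing \<alpha> is excluded by
            \<open>star_\<alpha>\<close>; hence \<open>x\<close> and the removed ridge
            \<open>y\<close> differ at a vertex \<open>a\<close> of \<alpha>, and
            \<open>\<sigma> - {a}\<close> can replace \<open>y\<close>.\<close>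
          have "\<not> \<alpha> \<subseteq> x" using star_\<alpha> step.prems by blast
          then have "a \<in> \<alpha>" using a b disjoint by blast
          have sub: "\<sigma> - {a} - {b} \<subseteq> x" using a b by blast
          have "card (x \<inter> (\<sigma> - {a})) = n"
          proof -
            \<comment> \<open>Otherwise \<open>x\<close> would contain \<beta>; so the intersection
              is no larger than \<open>\<sigma> - {a} - {b}\<close>.\<close>
            have "\<not> \<sigma> - {a} \<subseteq> x"
              using \<beta>_nonface[of x] xy disjoint \<open>a \<in> \<alpha>\<close> by blast
            then have "x \<inter> (\<sigma> - {a}) = \<sigma> - {a} - {b}" using sub by blast
            moreover have "a \<noteq> b" using \<open>a \<in> \<alpha>\<close> b disjoint by blast
            ultimately show ?thesis using card_minus2[of a b] \<open>a \<in> \<alpha>\<close> b by simp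
          qed
          moreover have "\<rho> \<subseteq> \<sigma> - {a}" using xy a b by blast
          moreover have "\<sigma> - {a} \<in> ridges \<sigma> \<alpha>" using \<open>a \<in> \<alpha>\<close> by (simp add: ridges_def)
          ultimately have "(x, \<sigma> - {a}) \<in> star_adj n F' \<rho>"
            using step.prems xy by (simp add: star_adj_def)
          then show ?thesis
            using \<open>a \<in> \<alpha>\<close> \<open>\<rho> \<subseteq> \<sigma> - {a}\<close> by blast
        qed
      qed
    qed
    from reach[of s] reach[of t] assms obtain a a' where
      "a \<in> \<alpha>" "\<rho> \<subseteq> \<sigma> - {a}" "(s, \<sigma> - {a}) \<in> ?R'" "a' \<in> \<alpha>" "\<rho> \<subseteq> \<sigma> - {a'}" "(t, \<sigma> - {a'}) \<in> ?R'"
      by blast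
    then show ?thesis using new sym by (meson rtrancl_trans)
  qed
qed

lemma normal_F': "normal n F'"
  unfolding normal_def using uniform_F' thin_F' connected_F' by blast

text \<open>By \<open>star_\<alpha>\<close> no survivor contains \<alpha>, so exactly the faces over
  \<alpha> disappear. Conversely, an old face outside the deleted join lies below no removed ridge,
  hence below a survivor.\<close>

lemma down_F':
  "down F' = (down F - join (Pow \<alpha>) (proper_faces \<beta>)) \<union> join (proper_faces \<alpha>) (Pow \<beta>)"
  (is "_ = ?R")
proof
  show "down F' \<subseteq> ?R"
  proof
    fix \<rho> assume "\<rho> \<in> down F'"
    then obtain t where t: "t \<in> F'" "\<rho> \<subseteq> t" by (auto simp: down_def)
    show "\<rho> \<in> ?R"
    proof (cases "t \<in> ridges \<sigma> \<alpha>")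
      case True
      with t show ?thesis
        by (auto simp: join_proper_faces_Pow[OF disjoint] ridges_def)
    next
      case False
      with t have "t \<in> F" "t \<notin> ridges \<sigma> \<beta>" by auto
      with t star_\<alpha> show ?thesis
        by (auto simp: join_proper_faces_Pow[OF disjoint] join_Pow_proper_faces[OF disjoint] down_def)
    qed
  qed
  show "?R \<subseteq> down F'"
  proof
    fix \<rho> assume "\<rho> \<in> ?R"
    then consider t where "t \<in> F" "\<rho> \<subseteq> t" "\<rho> \<notin> join (Pow \<alpha>) (proper_faces \<beta>)"
      | a where "a \<in> \<alpha>" "\<rho> \<subseteq> \<sigma> - {a}"
      by (auto simp: join_proper_faces_Pow[OF disjoint] down_def)
    then show "\<rho> \<in> down F'"
    proof cases
      case 1
      then have "t \<notin> ridges \<sigma> \<beta>"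
        by (auto simp: join_Pow_proper_faces[OF disjoint] ridges_def)
      with 1 show ?thesis by (auto simp: down_def)
    next
      case 2
      then show ?thesis by (auto simp: down_def ridges_def)
    qed
  qed
qed

text \<open>A subset of \<sigma> is an old face exactly when it misses some \<open>b\<close> in
  \<beta>: it then lies in \<open>\<sigma> - {b}\<close>, and \<beta> itself is no face.\<close>

lemma bistellar_move_down: "bistellar_move (int n) (down F) \<alpha> \<beta> (down F')"
proof -
  have "induced (down F) \<sigma> = join (Pow \<alpha>) (proper_faces \<beta>)"
  proof
    show "induced (down F) \<sigma> \<subseteq> join (Pow \<alpha>) (proper_faces \<beta>)"
      using \<beta>_nonface by (auto simp: join_Pow_proper_faces[OF disjoint] induced_def down_def)
    show "join (Pow \<alpha>) (proper_faces \<beta>) \<subseteq> induced (down F) \<sigma>"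
    proof
      fix \<rho> assume "\<rho> \<in> join (Pow \<alpha>) (proper_faces \<beta>)"
      then obtain b where "\<rho> \<subseteq> \<sigma> - {b}" "b \<in> \<beta>"
        by (auto simp: join_Pow_proper_faces[OF disjoint])
      then show "\<rho> \<in> induced (down F) \<sigma>"
        using ridge_\<beta>[of b] by (auto simp: induced_def down_def)
    qed
  qed
  moreover have "dim_complex (int n) (down F)"
    using dim_complex_down[OF uniform_F] by simp
  moreover have "face_dim \<alpha> + face_dim \<beta> = int n"
    using card card_Un_disjoint[OF finite_\<alpha> finite_\<beta> disjoint] by (simp add: face_dim_def)
  ultimately show ?thesis
    unfolding bistellar_move_def
    using down_F' finite_\<alpha> finite_\<beta> \<alpha>_ne \<beta>_ne disjoint by blast
qed

end

section \<open>Boundaries of shelled balls\<close>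

text \<open>A ridge opposite \<open>b\<close> in \<beta> lay in one old facet, and in only one
  because \<sigma> is a second facet over it; gluing makes it interior. A ridge opposite
  \<open>a\<close> in \<alpha> contains \<beta>, so only \<sigma> lies over it. Ridges outside
  \<sigma> do not notice the new facet.\<close>

lemma free_ridges_insert:
  assumes \<sigma>: "finite (\<alpha> \<union> \<beta>)" "card (\<alpha> \<union> \<beta>) = Suc n" and disj: "\<alpha> \<inter> \<beta> = {}"
    and new: "\<alpha> \<union> \<beta> \<notin> G" and thin: "thin n (insert (\<alpha> \<union> \<beta>) G)"
    and old: "\<And>b. b \<in> \<beta> \<Longrightarrow> \<exists>s\<in>G. \<alpha> \<union> \<beta> - {b} \<subseteq> s"
    and \<beta>: "\<And>s. s \<in> G \<Longrightarrow> \<not> \<beta> \<subseteq> s"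
  shows "ridges (\<alpha> \<union> \<beta>) \<beta> \<subseteq> free_ridges n G"
    and "free_ridges n (insert (\<alpha> \<union> \<beta>) G) =
      (free_ridges n G - ridges (\<alpha> \<union> \<beta>) \<beta>) \<union> ridges (\<alpha> \<union> \<beta>) \<alpha>"
proof -
  let ?\<sigma> = "\<alpha> \<union> \<beta>"
  have b: "?\<sigma> - {b} \<in> free_ridges n G \<and> ?\<sigma> - {b} \<notin> free_ridges n (insert ?\<sigma> G)"
    if "b \<in> \<beta>" for b
  proof -
    from old[OF that] obtain s where s: "s \<in> G" "?\<sigma> - {b} \<subseteq> s" by blast
    have c: "card (?\<sigma> - {b}) = n" using \<sigma> that by simp
    have "t = s" if "t \<in> G" "?\<sigma> - {b} \<subseteq> t" for t
      using thinD[OF thin c, of s t ?\<sigma>] s that new by blast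
    then have "?\<sigma> - {b} \<in> free_ridges n G"
      using s c unfolding free_ridges_def by blast
    moreover have "?\<sigma> - {b} \<notin> free_ridges n (insert ?\<sigma> G)"
    proof
      assume "?\<sigma> - {b} \<in> free_ridges n (insert ?\<sigma> G)"
      then have "s = ?\<sigma>" using s unfolding free_ridges_def by blast
      with s new show False by simp
    qed
    ultimately show ?thesis ..
  qed
  have a: "?\<sigma> - {a} \<in> free_ridges n (insert ?\<sigma> G)" if "a \<in> \<alpha>" for a
  proof -
    have "\<beta> \<subseteq> ?\<sigma> - {a}" using disj that by blast
    then have "\<not> ?\<sigma> - {a} \<subseteq> s" if "s \<in> G" for s using \<beta>[OF that] by blast
    moreover have "card (?\<sigma> - {a}) = n" using \<sigma> that by simp
    ultimately show ?thesis unfolding free_ridges_def by blast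
  qed
  have other: "\<tau> \<in> free_ridges n (insert ?\<sigma> G) \<longleftrightarrow> \<tau> \<in> free_ridges n G" if "\<not> \<tau> \<subseteq> ?\<sigma>" for \<tau>
    using that unfolding free_ridges_def by blast
  show "ridges ?\<sigma> \<beta> \<subseteq> free_ridges n G"
    using b by (auto simp: ridges_def)
  show "free_ridges n (insert ?\<sigma> G) = (free_ridges n G - ridges ?\<sigma> \<beta>) \<union> ridges ?\<sigma> \<alpha>"
  proof (rule set_eqI)
    fix \<tau>
    show "\<tau> \<in> free_ridges n (insert ?\<sigma> G) \<longleftrightarrow> \<tau> \<in> (free_ridges n G - ridges ?\<sigma> \<beta>) \<union> ridges ?\<sigma> \<alpha>"
    proof (cases "\<tau> \<subseteq> ?\<sigma>")
      case False
      then have "\<tau> \<notin> ridges ?\<sigma> \<beta>" "\<tau> \<notin> ridges ?\<sigma> \<alpha>" by (auto simp: ridges_def)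
      with other[OF False] show ?thesis by blast
    next
      case True
      show ?thesis
      proof (cases "card \<tau> = n")
        case False
        then show ?thesis using \<sigma> by (auto simp: free_ridges_def ridges_def)
      next
        case card: True
        obtain x where x: "x \<in> ?\<sigma>" "\<tau> = ?\<sigma> - {x}"
          using subset_eq_Diff_singleton[OF \<sigma>(1) True] card \<sigma>(2) by auto
        have inj: "x = y" if "?\<sigma> - {x} = ?\<sigma> - {y}" "y \<in> ?\<sigma>" for y
          using that x by blast
        show ?thesis
        proof (cases "x \<in> \<beta>")
          case True
          then have "\<tau> \<notin> ridges ?\<sigma> \<alpha>"
            using inj disj x by (auto simp: ridges_def)
          with True b[OF True] x show ?thesis by (auto simp: ridges_def)
        next
          case False
          then have "\<tau> \<in> ridges ?\<sigma> \<alpha>" using x by (auto simp: ridges_def)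
          with a[of x] x False show ?thesis by auto
        qed
      qed
    qed
  qed
qed

section \<open>Shelling moves as ridge exchanges\<close>

lemma weak_pseudomanifold_thin:
  assumes "weak_pseudomanifold (int n) X"
  shows "thin n (facets X)"
  unfolding thin_def
proof (intro allI impI)
  fix \<rho> s t u
  assume *: "card \<rho> = n" "s \<in> facets X" "t \<in> facets X" "u \<in> facets X" "\<rho> \<subseteq> s" "\<rho> \<subseteq> t" "\<rho> \<subseteq> u"
  have pure: "pure_complex (int (Suc n) - 1) X"
    using assms by (simp add: weak_pseudomanifold_def)
  have "\<rho> \<in> X"
    using * by (subst pure_complex_facets(2)[OF pure]) (auto simp: down_def)
  then have "card {s \<in> facets X. \<rho> \<subseteq> s} \<le> 2"
    using assms * by (simp add: weak_pseudomanifold_def face_dim_def)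
  moreover have "card {s, t, u} \<le> card {s \<in> facets X. \<rho> \<subseteq> s}"
    using * pure_complex_facets(1)[OF pure] by (intro card_mono) (auto simp: uniform_def)
  ultimately have "card {s, t, u} \<le> 2" by simp
  then show "s = t \<or> s = u \<or> t = u"
    by (auto simp: card_insert_if split: if_splits)
qed

text \<open>The move itself only says which facets are gained; none is lost, because a facet of
  \<open>Y\<close> already has full dimension in the pure complex \<open>X\<close>.\<close>

lemma shelling_move_facets:
  assumes "shelling_move (int n) Y \<alpha> \<beta> X"
  shows "facets X = insert (\<alpha> \<union> \<beta>) (facets Y)"
proof -
  have pure: "pure_complex (int (Suc n) - 1) Y" "pure_complex (int (Suc n) - 1) X"
    and "Y \<subseteq> X" "facets X - facets Y = {\<alpha> \<union> \<beta>}"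
    using assms by (auto simp: shelling_move_def)
  have "facets Y \<subseteq> facets X"
  proof
    fix s assume s: "s \<in> facets Y"
    then have "s \<in> X" using \<open>Y \<subseteq> X\<close> by (auto simp: facets_def)
    then show "s \<in> facets X"
      using uniformD(2)[OF pure_complex_facets(1)[OF pure(1)] s] pure_complex_facetI[OF pure(2)]
      by simp
  qed
  with \<open>facets X - facets Y = {\<alpha> \<union> \<beta>}\<close> show ?thesis by blast
qed

lemma shelling_move_ridge_exchange:
  assumes move: "shelling_move (int (Suc n)) Y \<alpha> \<beta> X" and "face_dim \<beta> < int (Suc n)"
    and thin: "thin (Suc n) (facets X)" and normal: "normal n (free_ridges (Suc n) (facets Y))"
  shows "ridge_exchange n (free_ridges (Suc n) (facets Y)) \<alpha> \<beta>"
    and "free_ridges (Suc n) (facets X) = (free_ridges (Suc n) (facets Y)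
      - ridges (\<alpha> \<union> \<beta>) \<beta>) \<union> ridges (\<alpha> \<union> \<beta>) \<alpha>"
proof -
  let ?\<sigma> = "\<alpha> \<union> \<beta>"
  have pure: "pure_complex (int (Suc (Suc n)) - 1) Y" "pure_complex (int (Suc (Suc n)) - 1) X"
    and disj: "\<alpha> \<inter> \<beta> = {}" and ne: "\<beta> \<noteq> {}" and diff: "facets X - facets Y = {?\<sigma>}"
    and ind: "induced Y ?\<sigma> = join (Pow \<alpha>) (proper_faces \<beta>)"
    using move by (auto simp: shelling_move_def)
  note facets = shelling_move_facets[OF move]
  note uX = pure_complex_facets[OF pure(2)] and uY = pure_complex_facets[OF pure(1)]
  have \<sigma>: "finite ?\<sigma>" "card ?\<sigma> = Suc (Suc n)" "?\<sigma> \<notin> facets Y"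
    using uniformD[OF uX(1), of ?\<sigma>] diff by auto
  have old: "\<exists>s\<in>facets Y. ?\<sigma> - {b} \<subseteq> s" if "b \<in> \<beta>" for b
  proof -
    have "?\<sigma> - {b} \<in> induced Y ?\<sigma>"
      unfolding ind join_Pow_proper_faces[OF disj] using that by blast
    then have "?\<sigma> - {b} \<in> down (facets Y)"
      using uY(2) by (simp add: induced_def)
    then show ?thesis by (simp add: down_def)
  qed
  \<comment> \<open>A face of \<open>Y\<close> inside \<sigma> lies in the join and so misses a
    vertex of \<beta>; hence \<beta> is not a face of \<open>Y\<close>.\<close>
  have \<beta>: "\<not> \<beta> \<subseteq> s" if "s \<in> facets Y" for s
  proof
    assume "\<beta> \<subseteq> s"
    then have "\<beta> \<in> down (facets Y)" using that by (auto simp: down_def)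
    then have "\<beta> \<in> induced Y ?\<sigma>" using uY(2) by (simp add: induced_def)
    then show False unfolding ind join_Pow_proper_faces[OF disj] by blast
  qed
  note ins = free_ridges_insert[OF \<sigma>(1,2) disj \<sigma>(3) thin[unfolded facets] old \<beta>]
  show "free_ridges (Suc n) (facets X) = (free_ridges (Suc n) (facets Y)
      - ridges ?\<sigma> \<beta>) \<union> ridges ?\<sigma> \<alpha>"
    unfolding facets by (rule ins(2))
  show "ridge_exchange n (free_ridges (Suc n) (facets Y)) \<alpha> \<beta>"
  proof
    \<comment> \<open>With \<alpha> empty, \<beta> would be the whole simplex, of dimension
      \<open>n + 1\<close>, against the index bound.\<close>
    show "\<alpha> \<noteq> {}"
      using assms(2) \<sigma>(2) by (auto simp: face_dim_def)
    show "ridges ?\<sigma> \<beta> \<subseteq> free_ridges (Suc n) (facets Y)"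
      by (rule ins(1))
    show "\<not> \<beta> \<subseteq> t" if t: "t \<in> free_ridges (Suc n) (facets Y)" for t
    proof -
      from t obtain s where "s \<in> facets Y" "t \<subseteq> s" by (auto simp: free_ridges_def)
      then show ?thesis using \<beta> by blast
    qed
  qed (use normal \<sigma> disj ne in auto)
qed

section \<open>Induction along the shelling\<close>

lemma boundary_Pow:
  assumes "finite \<sigma>" "card \<sigma> = Suc n"
  shows "free_ridges n (facets (Pow \<sigma>)) = ridges \<sigma> \<sigma>" "boundary (Pow \<sigma>) = proper_faces \<sigma>"
proof -
  have facets: "facets (Pow \<sigma>) = {\<sigma>}"
    by (auto simp: facets_def)
  have down: "Pow \<sigma> = down {\<sigma>}" by (auto simp: down_def)
  have "dim_complex (int n) (Pow \<sigma>)"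
    using dim_complex_down[of "Suc n" "{\<sigma>}"] assms by (simp add: down uniform_def)
  then have pure: "pure_complex (int n) (Pow \<sigma>)"
    using assms by (simp add: pure_complex_def facets face_dim_def)
  show *: "free_ridges n (facets (Pow \<sigma>)) = ridges \<sigma> \<sigma>"
    unfolding facets free_ridges_def ridges_def
    using assms by (auto elim!: subset_eq_Diff_singleton[OF assms(1)])
  have "insert {} (down (ridges \<sigma> \<sigma>)) = proper_faces \<sigma>"
    using assms by (auto simp: down_def ridges_def proper_faces_def)
  then show "boundary (Pow \<sigma>) = proper_faces \<sigma>"
    unfolding boundary_eq_down_free_ridges[OF pure] * .
qed

text \<open>A normal family has a member, so the explicitly inserted empty face is already
  present.\<close>

lemma boundary_normal:
  assumes "pure_complex (int (Suc n)) X" "normal n (free_ridges (Suc n) (facets X))"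
  shows "boundary X = down (free_ridges (Suc n) (facets X))"
  using assms(2) unfolding boundary_eq_down_free_ridges[OF assms(1)]
  by (auto simp: normal_def uniform_def down_def)

text \<open>Normality and the sequence of bistellar moves are proved together, since each exchange
  needs the boundary before it to be normal.\<close>

lemma shelling_moves_boundary:
  assumes "(\<lambda>Y Z. \<exists>\<alpha> \<beta>. shelling_move (int (Suc n)) Y \<alpha> \<beta> Z \<and> face_dim \<beta> < k)\<^sup>*\<^sup>* (Pow \<sigma>) X"
    and "finite \<sigma>" "card \<sigma> = n + 2" "k \<le> int (Suc n)" "thin (Suc n) (facets X)"
  shows "normal n (free_ridges (Suc n) (facets X)) \<and>
    (\<lambda>Y Z. \<exists>\<alpha> \<beta>. bistellar_move (int n) Y \<alpha> \<beta> Z \<and> face_dim \<beta> < k)\<^sup>*\<^sup>* (proper_faces \<sigma>) (boundary X)"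
  using assms(1,5)
proof (induction rule: rtranclp_induct)
  case base
  show ?case
    using normal_ridges[OF assms(2,3)] boundary_Pow[of \<sigma> "Suc n"] assms(2,3) by simp
next
  case (step Y X)
  then obtain \<alpha> \<beta> where move: "shelling_move (int (Suc n)) Y \<alpha> \<beta> X" and "face_dim \<beta> < k"
    by blast
  \<comment> \<open>Thinness is known for the final complex and descends to the earlier ones, as
    moves only add facets.\<close>
  have "thin (Suc n) (facets Y)"
    using step.prems shelling_move_facets[OF move] by (auto intro: thin_subset)
  with step.IH have normal: "normal n (free_ridges (Suc n) (facets Y))"
    and bi: "(\<lambda>Y Z. \<exists>\<alpha> \<beta>. bistellar_move (int n) Y \<alpha> \<beta> Z \<and> face_dim \<beta> < k)\<^sup>*\<^sup>*
      (proper_faces \<sigma>) (boundary Y)"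
    by auto
  have "face_dim \<beta> < int (Suc n)" using \<open>face_dim \<beta> < k\<close> assms(4) by simp
  note ex = shelling_move_ridge_exchange[OF move this step.prems normal]
  interpret ridge_exchange n "free_ridges (Suc n) (facets Y)" \<alpha> \<beta> by (rule ex(1))
  have "normal n (free_ridges (Suc n) (facets X))"
    unfolding ex(2) by (rule normal_F')
  moreover from this normal have "bistellar_move (int n) (boundary Y) \<alpha> \<beta> (boundary X)"
    using bistellar_move_down move boundary_normal[of n X] boundary_normal[of n Y]
    unfolding ex(2) shelling_move_def by simp
  ultimately show ?case
    using bi \<open>face_dim \<beta> < k\<close> by (blast intro: rtranclp.rtrancl_into_rtrancl)
qed

theorem corollary2p4:
  fixes k d :: int and B :: "'a set set"
  assumes "0 \<le> k" and "k \<le> d + 1"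
    and "shelled_ball k (d + 1) B"
  shows "stellated_sphere k d (boundary B)"
proof -
  obtain \<sigma> where \<sigma>: "finite \<sigma>" "face_dim \<sigma> = d + 1"
    and moves: "(\<lambda>Y Z. \<exists>\<alpha> \<beta>. shelling_move (d + 1) Y \<alpha> \<beta> Z \<and> face_dim \<beta> < k)\<^sup>*\<^sup>* (Pow \<sigma>) B"
    and wp: "weak_pseudomanifold (d + 1) B"
    using assms(3) by (auto simp: shelled_ball_def standard_ball_def pseudomanifold_def)
  have sphere: "standard_sphere d (proper_faces \<sigma>)"
    using \<sigma> by (auto simp: standard_sphere_def)
  show ?thesis
  proof (cases "d = -1")
    case True
    \<comment> \<open>Here \<open>k \<le> 0\<close>, whereas a non-empty \<beta> has dimension at
      least 0; so the ball is still a single point.\<close>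
    have no_move: "\<not> face_dim \<beta> < k" if "shelling_move (d + 1) Y \<alpha> \<beta> Z" for Y Z \<alpha> and \<beta> :: "'a set"
    proof -
      from that have "pure_complex (d + 1) Z" "\<beta> \<in> Z" "\<beta> \<noteq> {}"
        unfolding shelling_move_def by blast+
      then have "finite \<beta>"
        unfolding pure_complex_def dim_complex_def simplicial_complex_def by blast
      with \<open>\<beta> \<noteq> {}\<close> have "card \<beta> > 0" by (simp add: card_gt_0_iff)
      then show ?thesis using assms(2) True by (simp add: face_dim_def)
    qed
    have "B = Pow \<sigma>"
      using moves by (cases rule: rtranclp.cases) (auto dest: no_move)
    moreover have card: "card \<sigma> = Suc 0" using \<sigma> True by (simp add: face_dim_def)
    ultimately have B: "boundary B = proper_faces \<sigma>"
      using boundary_Pow(2)[OF \<sigma>(1) card] by simp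
    \<comment> \<open>The boundary of a point is generated by the empty facet alone, a uniform
      family with \<open>n = 0\<close> and so of dimension -1.\<close>
    have "proper_faces \<sigma> = down {{}}"
      using card by (auto simp: card_1_singleton_iff proper_faces_def down_def)
    then have "dim_complex d (proper_faces \<sigma>)"
      using dim_complex_down[of 0 "{{}}"] True by (simp add: uniform_def)
    with sphere show ?thesis
      unfolding stellated_sphere_def B by blast
  next
    case False
    define n where "n = nat d"
    have d: "d = int n" using assms(1,2) False by (simp add: n_def)
    have d1: "d + 1 = int (Suc n)" using d by simp
    have thin: "thin (Suc n) (facets B)"
      using wp unfolding d1 by (rule weak_pseudomanifold_thin)
    have card: "card \<sigma> = n + 2" using \<sigma>(2) d by (simp add: face_dim_def)
    have normal: "normal n (free_ridges (Suc n) (facets B))"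
      and bi: "(\<lambda>Y Z. \<exists>\<alpha> \<beta>. bistellar_move d Y \<alpha> \<beta> Z \<and> face_dim \<beta> < k)\<^sup>*\<^sup>*
        (proper_faces \<sigma>) (boundary B)"
      using shelling_moves_boundary[OF moves[unfolded d1] \<sigma>(1) card assms(2)[unfolded d1] thin] d
      by auto
    have "boundary B = down (free_ridges (Suc n) (facets B))"
      using boundary_normal[OF _ normal] wp unfolding d1 by (simp add: weak_pseudomanifold_def)
    moreover have "dim_complex d (down (free_ridges (Suc n) (facets B)))"
      using dim_complex_down[of "Suc n" "free_ridges (Suc n) (facets B)"] normal d
      by (simp add: normal_def)
    ultimately show ?thesis
      unfolding stellated_sphere_def using sphere bi by auto
  qed
qed

end
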